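(* Let $n \ge 0$ be an integer. 1. For $a \in \{0,1\}$ and every integer $r$ with $0 \le r \le n$, the polynomial $$Z_{2n+a,n}^{(r)}(q) = {2n+a \brack n-r} - {2n+a \brack n-r-1}$$ enumerates the subset of $\mathscr{P}^{(n)}_{n+a}$ specified by $\mathcal{E}_1(\bullet; n) = r$; that is, $$Z_{2n+a,n}^{(r)}(q) = \sum_{\lambda \in \mathscr{P}^{(n)}_{n+a},\ \mathcal{E}_1(\lambda;n)=r} q^{|\lambda|}.$$ 2. The polynomial $B_n(q) = \sum_{r=0}^n (-1)^r {2n+1 \brack n-r}$ enumerates the subset of $\mathscr{P}^{(n)}_{n+1}$ specified by even $\mathcal{E}_1(\bullet;n)$; that is, $$B_n(q) = \sum_{\lambda \in \mathscr{P}^{(n)}_{n+1},\ \mathcal{E}_1(\lambda;n) \text{ even}} q^{|\lambda|}.$$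
   Context: $(z;q)_n = \prod_{k=1}^n (1-zq^{k-1})$ for $n\ge 1$, $(z;q)_0=1$. The Gaussian polynomial is ${n \brack m} = \frac{(q;q)_n}{(q;q)_m (q;q)_{n-m}}$ if $0 \le m \le n$, and $0$ otherwise. $\mathscr{P}^{(n)}_l$ is the set of integer partitions (including the empty partition $\emptyset$) having at most $n$ parts with each part at most $l$. $|\lambda|$ is the sum of the parts of $\lambda$. Frobenius representation: if the main diagonal of the Ferrers diagram of $\lambda$ consists of the $d$ cells $(i,i)$, $1 \le i \le d$, let $x_i$ be the number of cells in row $i$ strictly to the right of $(i,i)$ and $y_i$ the number of cells in column $i$ strictly below $(i,i)$; then $F(\lambda)=(x_1,\dots,x_d \mid y_1,\dots,y_d)$ (with $d=0$ for $\lambda=\emptyset$). For a fixed integer $n \ge 0$ and a partition $\lambda$ with $F(\lambda)=(x_1,\dots,x_d \mid y_1,\dots,y_d)$, define $$\mathcal{E}_1(\lambda;n) = \max_{0\le i\le d}(y_i - x_{i+1}) - 1, \qquad y_0 := n,\ x_{d+1} := -1.$$ *)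

theory Defs
  imports "HOL-Computational_Algebra.Polynomial"
begin

definition qpoch :: "'a \<Rightarrow> 'a \<Rightarrow> nat \<Rightarrow> 'a::comm_ring_1" where
  "qpoch z q n = (\<Prod>k=1..n. 1 - z * q ^ (k - 1))"

abbreviation qvar :: "int poly" where
  "qvar \<equiv> [:0, 1:]"

text \<open>The lower index is an integer because it takes the value \<open>-1\<close>. The operation
  \<open>div\<close> is exact here; see \<open>gauss_poly_mult\<close> below.\<close>

definition gauss_poly :: "nat \<Rightarrow> int \<Rightarrow> int poly" where
  "gauss_poly n m =
     (if 0 \<le> m \<and> m \<le> int n
      then qpoch qvar qvar n div (qpoch qvar qvar (nat m) * qpoch qvar qvar (n - nat m))
      else 0)"

lemma qpoch_Suc: "qpoch z q (Suc n) = qpoch z q n * (1 - z * q ^ n)"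
  by (simp add: qpoch_def)

lemma qpoch_dvd:
  fixes q :: "'a::comm_ring_1"
  shows "qpoch q q i * qpoch q q j dvd qpoch q q (i + j)"
proof (induction "i + j" arbitrary: i j)
  case 0
  then show ?case by (simp add: qpoch_def)
next
  case (Suc n)
  show ?case
  proof (cases "i = 0 \<or> j = 0")
    case True
    then show ?thesis by (auto simp: qpoch_def)
  next
    case False
    then obtain a b where ab: "i = Suc a" "j = Suc b"
      by (metis not0_implies_Suc)
    with Suc have n: "n = a + Suc b" "n = Suc a + b" by auto
    have d1: "qpoch q q a * qpoch q q (Suc b) dvd qpoch q q n"
      using Suc(1)[OF n(1)] n by simp
    have d2: "qpoch q q (Suc a) * qpoch q q b dvd qpoch q q n"
      using Suc(1)[OF n(2)] n by simp
    have e1: "qpoch q q i * qpoch q q j dvd qpoch q q n * (1 - q ^ Suc a)"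
      using mult_dvd_mono[OF d1 dvd_refl, of "1 - q ^ Suc a"]
      by (simp add: ab qpoch_Suc mult_ac)
    have e2: "qpoch q q i * qpoch q q j dvd qpoch q q n * (1 - q ^ Suc b)"
      using mult_dvd_mono[OF d2 dvd_refl, of "1 - q ^ Suc b"]
      by (simp add: ab qpoch_Suc mult_ac)
    have "qpoch q q (i + j) = qpoch q q n * (1 - q ^ Suc a)
            + q ^ Suc a * (qpoch q q n * (1 - q ^ Suc b))"
      by (simp add: Suc(2)[symmetric] qpoch_Suc n(1) algebra_simps power_add)
    with e1 e2 show ?thesis by (simp add: dvd_add dvd_mult)
  qed
qed

lemma gauss_poly_mult:
  assumes "m \<le> n"
  shows "gauss_poly n (int m) * (qpoch qvar qvar m * qpoch qvar qvar (n - m)) = qpoch qvar qvar n"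
  using qpoch_dvd[of qvar m "n - m"] assms by (simp add: gauss_poly_def)

definition is_partition :: "nat list \<Rightarrow> bool" where
  "is_partition \<mu> \<longleftrightarrow> sorted_wrt (\<ge>) \<mu> \<and> (\<forall>p\<in>set \<mu>. 0 < p)"

definition partitions_in_box :: "nat \<Rightarrow> nat \<Rightarrow> nat list set" where
  "partitions_in_box n l = {\<mu>. is_partition \<mu> \<and> length \<mu> \<le> n \<and> (\<forall>p\<in>set \<mu>. p \<le> l)}"

lemma finite_partitions_in_box: "finite (partitions_in_box n l)"
  by (rule finite_subset[OF _ finite_lists_length_le[of "{..l}" n]])
     (auto simp: partitions_in_box_def)

text \<open>Cells are pairs (row, column), both counted from 1.\<close>

definition ferrers :: "nat list \<Rightarrow> (nat \<times> nat) set" where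
  "ferrers \<mu> = {(i, j). 1 \<le> i \<and> i \<le> length \<mu> \<and> 1 \<le> j \<and> j \<le> \<mu> ! (i - 1)}"

definition durfee :: "nat list \<Rightarrow> nat" where
  "durfee \<mu> = card {i. (i, i) \<in> ferrers \<mu>}"

definition arm :: "nat list \<Rightarrow> nat \<Rightarrow> nat" where
  "arm \<mu> i = card {j. i < j \<and> (i, j) \<in> ferrers \<mu>}"

definition leg :: "nat list \<Rightarrow> nat \<Rightarrow> nat" where
  "leg \<mu> i = card {k. i < k \<and> (k, i) \<in> ferrers \<mu>}"

definition frobenius :: "nat list \<Rightarrow> nat list \<times> nat list" where
  "frobenius \<mu> = (map (arm \<mu>) [1..<durfee \<mu> + 1], map (leg \<mu>) [1..<durfee \<mu> + 1])"

text \<open>With \<open>frobenius \<mu> = ([x\<^sub>1, \<dots>, x\<^sub>d], [y\<^sub>1, \<dots>, y\<^sub>d])\<close>, the lists \<open>X\<close> and \<open>Y\<close> are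
  \<open>[x\<^sub>1, \<dots>, x\<^sub>d, -1]\<close> and \<open>[n, y\<^sub>1, \<dots>, y\<^sub>d]\<close>; as list positions are counted from 0,
  \<open>X ! i\<close> is \<open>x\<^sub>i\<^sub>+\<^sub>1\<close> and \<open>Y ! i\<close> is \<open>y\<^sub>i\<close>, where \<open>x\<^sub>d\<^sub>+\<^sub>1 = -1\<close> and \<open>y\<^sub>0 = n\<close>.\<close>

definition E1 :: "nat list \<Rightarrow> nat \<Rightarrow> int" where
  "E1 \<mu> n =
     (let (xs, ys) = frobenius \<mu>;
          X = map int xs @ [-1];
          Y = int n # map int ys
      in Max {Y ! i - X ! i | i. i \<le> durfee \<mu>} - 1)"

definition Z_poly :: "nat \<Rightarrow> nat \<Rightarrow> nat \<Rightarrow> int poly" where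
  "Z_poly N n r = gauss_poly N (int n - int r) - gauss_poly N (int n - int r - 1)"

definition B_poly :: "nat \<Rightarrow> int poly" where
  "B_poly n = (\<Sum>r=0..n. (-1) ^ r * gauss_poly (2 * n + 1) (int n - int r))"

end

theory Submission
  imports Defs
begin

text \<open>
  The key is a size-preserving bijection, for \<open>r \<le> n \<le> l + r\<close>, between the partitions in the
  \<open>n \<times> l\<close> box (at most \<open>n\<close> parts, each at most \<open>l\<close>) with \<open>E1 \<ge> r\<close> and all partitions in the
  \<open>(l + r) \<times> (n - r)\<close> box. Since a box is enumerated by a Gaussian polynomial
  (\<open>gauss_poly_eq_box_sum\<close>), the partitions in the \<open>n \<times> l\<close> box with \<open>E1 \<ge> r\<close> are enumerated by
  \<open>gauss_poly (n + l) (n - r)\<close> (\<open>box_sum_E1_ge\<close>). The difference of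
  this identity at \<open>r\<close> and \<open>r + 1\<close> isolates \<open>E1 = r\<close>. The alternating sum over \<open>r\<close> isolates even \<open>E1\<close>: a partition with \<open>E1 = e\<close> is counted with
  the coefficient \<open>1 - 1 + 1 - \<dots>\<close> of \<open>e + 1\<close> terms.

  The bijection acts on Frobenius symbols. The condition \<open>E1 \<ge> r\<close> says that
  \<open>y\<^sub>i > x\<^sub>i\<^sub>+\<^sub>1 + r\<close> for some \<open>i\<close> with \<open>0 \<le> i \<le> d\<close>. Take the last such \<open>i\<close>, replace
  \<open>(x\<^sub>j, y\<^sub>j)\<close> by \<open>(y\<^sub>j - r, x\<^sub>j + r)\<close> for every \<open>j\<close> with \<open>1 \<le> j \<le> i\<close>, and keep the rest. Both rows
  remain strictly decreasing at the seam: in the first row by the choice of \<open>i\<close>, in the second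
  because \<open>i\<close> is the last such index, so that \<open>y\<^sub>i\<^sub>+\<^sub>1 \<le> x\<^sub>i\<^sub>+\<^sub>2 + r < x\<^sub>i + r\<close>. The last such
  index is the same for the new symbol, so the operation (\<open>flip\<close>) is an involution, and it
  preserves the size \<open>\<Sum> (x\<^sub>j + y\<^sub>j + 1)\<close>.
\<close>

section \<open>Gaussian polynomials count partitions in a box\<close>

lemma box_0_left: "partitions_in_box 0 l = {[]}"
  by (auto simp: partitions_in_box_def is_partition_def)

lemma box_0_right: "partitions_in_box n 0 = {[]}"
proof -
  have "\<mu> = []" if "\<mu> \<in> partitions_in_box n 0" for \<mu>
    using that by (cases \<mu>) (auto simp: partitions_in_box_def is_partition_def)
  then show ?thesis by (auto simp: partitions_in_box_def is_partition_def)
qed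

text \<open>Split according to whether the largest possible part occurs.\<close>

lemma box_Suc_Suc:
  "partitions_in_box (Suc n) (Suc l) =
     partitions_in_box (Suc n) l \<union> (#) (Suc l) ` partitions_in_box n (Suc l)" (is "?L = ?R")
proof
  show "?L \<subseteq> ?R"
  proof
    fix \<mu> assume "\<mu> \<in> ?L"
    then show "\<mu> \<in> ?R"
      by (cases \<mu>)
        (force simp: partitions_in_box_def is_partition_def le_Suc_eq image_iff)+
  qed
  show "?R \<subseteq> ?L"
    by (auto simp: partitions_in_box_def is_partition_def)
qed

lemma box_sum_Suc_Suc:
  "(\<Sum>\<mu>\<in>partitions_in_box (Suc n) (Suc l). qvar ^ sum_list \<mu>) =
     (\<Sum>\<mu>\<in>partitions_in_box (Suc n) l. qvar ^ sum_list \<mu>)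
     + qvar ^ Suc l * (\<Sum>\<mu>\<in>partitions_in_box n (Suc l). qvar ^ sum_list \<mu>)"
proof -
  have "partitions_in_box (Suc n) l \<inter> (#) (Suc l) ` partitions_in_box n (Suc l) = {}"
    by (auto simp: partitions_in_box_def)
  then show ?thesis
    unfolding box_Suc_Suc
    by (subst sum.union_disjoint)
      (simp_all add: finite_partitions_in_box sum.reindex sum_distrib_left power_add mult_ac)
qed

text \<open>In the inductive step, the two terms of the recurrence for boxes carry the factors
  \<open>1 - q\<^bsup>b+1\<^esup>\<close> and \<open>q\<^bsup>b+1\<^esup> (1 - q\<^bsup>a+1\<^esup>)\<close>, which add up to the last factor
  \<open>1 - q\<^bsup>a+b+2\<^esup>\<close> of the right-hand side.\<close>

lemma box_sum_mult:
  "(\<Sum>\<mu>\<in>partitions_in_box n l. qvar ^ sum_list \<mu>) * (qpoch qvar qvar n * qpoch qvar qvar l)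
     = qpoch qvar qvar (n + l)"
proof (induction "n + l" arbitrary: n l)
  case 0
  then show ?case by (simp add: box_0_left qpoch_def)
next
  case (Suc k)
  let ?G = "\<lambda>n l. \<Sum>\<mu>\<in>partitions_in_box n l. qvar ^ sum_list \<mu>"
  let ?p = "qpoch qvar qvar"
  show ?case
  proof (cases "n = 0 \<or> l = 0")
    case True
    then show ?thesis by (auto simp: box_0_left box_0_right qpoch_def)
  next
    case False
    then obtain a b where ab: "n = Suc a" "l = Suc b"
      by (metis not0_implies_Suc)
    have k: "k = Suc a + b" "k = a + Suc b" using Suc(2) ab by auto
    have IH: "?G (Suc a) b * (?p (Suc a) * ?p b) = ?p k"
      "?G a (Suc b) * (?p a * ?p (Suc b)) = ?p k"
      using Suc(1)[OF k(1)] Suc(1)[OF k(2)] k by auto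
    have "?G n l * (?p n * ?p l) =
        (?G (Suc a) b * (?p (Suc a) * ?p b)) * (1 - qvar ^ Suc b)
        + qvar ^ Suc b * ((?G a (Suc b) * (?p a * ?p (Suc b))) * (1 - qvar ^ Suc a))"
      unfolding ab box_sum_Suc_Suc qpoch_Suc[of _ _ a] qpoch_Suc[of _ _ b] power_Suc[symmetric]
      by (simp only: algebra_simps)
    also have "\<dots> = ?p k * (1 - qvar ^ Suc k)"
      unfolding IH by (simp add: k(1) algebra_simps power_add)
    also have "\<dots> = ?p (n + l)"
      using Suc(2) by (metis qpoch_Suc power_Suc)
    finally show ?thesis .
  qed
qed

lemma qpoch_qvar_nonzero: "qpoch qvar qvar n \<noteq> 0"
proof -
  have "1 - qvar * qvar ^ k \<noteq> 0" for k
  proof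
    assume "1 - qvar * qvar ^ k = 0"
    then have "poly (1 - qvar * qvar ^ k) 0 = poly 0 0" by (rule arg_cong)
    then show False by simp
  qed
  then show ?thesis by (simp add: qpoch_def)
qed

lemma gauss_poly_eq_box_sum:
  "gauss_poly (n + l) (int l) = (\<Sum>\<mu>\<in>partitions_in_box n l. qvar ^ sum_list \<mu>)"
proof -
  let ?p = "qpoch qvar qvar"
  have "gauss_poly (n + l) (int l) * (?p n * ?p l) =
      (\<Sum>\<mu>\<in>partitions_in_box n l. qvar ^ sum_list \<mu>) * (?p n * ?p l)"
    unfolding box_sum_mult using gauss_poly_mult[of l "n + l"] by (simp add: mult_ac)
  then show ?thesis by (simp add: qpoch_qvar_nonzero)
qed


section \<open>The involution on Frobenius symbols\<close>

text \<open>A Frobenius symbol is represented by the list of its columns \<open>(x\<^sub>i, y\<^sub>i)\<close>. The predicate makes both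
  rows strictly decreasing and bounds the first row by \<open>l\<close> and the second by \<open>n\<close>, so it describes the
  symbols of partitions in the \<open>n \<times> l\<close> box. The bounds of a tail are the entries of the column
  before it, which makes every tail of a symbol an instance of the same predicate.\<close>

fun fits :: "nat \<Rightarrow> nat \<Rightarrow> (nat \<times> nat) list \<Rightarrow> bool" where
  "fits l n [] \<longleftrightarrow> True"
| "fits l n ((x, y) # zs) \<longleftrightarrow> x < l \<and> y < n \<and> fits x y zs"

text \<open>The condition that \<open>y\<^sub>i > x\<^sub>i\<^sub>+\<^sub>1 + r\<close> for some \<open>i\<close>, where \<open>y\<^sub>0 = n\<close> and \<open>x\<^sub>d\<^sub>+\<^sub>1 = -1\<close>; the
  latter turns the condition at \<open>i = d\<close> into \<open>r \<le> y\<^sub>d\<close>.\<close>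

fun exceeds :: "nat \<Rightarrow> nat \<Rightarrow> (nat \<times> nat) list \<Rightarrow> bool" where
  "exceeds r n [] \<longleftrightarrow> r \<le> n"
| "exceeds r n ((x, y) # zs) \<longleftrightarrow> x + r < n \<or> exceeds r y zs"

text \<open>A column \<open>(x, y)\<close> with tail \<open>zs\<close> lies at or before the last index with \<open>y\<^sub>i > x\<^sub>i\<^sub>+\<^sub>1 + r\<close> exactly
  if such an index exists from this column onwards, which is \<open>exceeds r y zs\<close>. The recursion
  therefore never has to locate the last index.\<close>

fun flip :: "nat \<Rightarrow> (nat \<times> nat) list \<Rightarrow> (nat \<times> nat) list" where
  "flip r [] = []"
| "flip r ((x, y) # zs) = (if exceeds r y zs then (y - r, x + r) else (x, y)) # flip r zs"

definition weight :: "(nat \<times> nat) list \<Rightarrow> nat" where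
  "weight zs = (\<Sum>(x, y)\<leftarrow>zs. Suc (x + y))"

lemma weight_simps [simp]:
  "weight [] = 0" "weight ((x, y) # zs) = Suc (x + y) + weight zs"
  by (simp_all add: weight_def)

lemma exceeds_imp_le: "fits l n zs \<Longrightarrow> exceeds r n zs \<Longrightarrow> r \<le> n"
  by (induction l n zs rule: fits.induct) auto

lemma exceeds_0: "fits l n zs \<Longrightarrow> exceeds 0 n zs"
  by (induction l n zs rule: fits.induct) auto

text \<open>This is the inequality \<open>y\<^sub>i\<^sub>+\<^sub>1 < x\<^sub>i\<^sub>+\<^sub>1 + r\<close> that makes the flipped part of a symbol fit on the part
  that is kept.\<close>

lemma not_exceeds_imp_less: "fits l n zs \<Longrightarrow> \<not> exceeds r n zs \<Longrightarrow> n < l + r"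
  by (cases zs) auto

lemma flip_id: "\<not> exceeds r n zs \<Longrightarrow> flip r zs = zs"
  by (induction r n zs rule: exceeds.induct) auto

lemma fits_flip: "fits l n zs \<Longrightarrow> exceeds r n zs \<Longrightarrow> fits (n - r) (l + r) (flip r zs)"
proof (induction l n zs rule: fits.induct)
  case (2 l n x y zs)
  show ?case
  proof (cases "exceeds r y zs")
    case True
    then show ?thesis using 2 exceeds_imp_le[of x y zs r] by auto
  next
    case False
    then show ?thesis
      using 2 not_exceeds_imp_less[of x y zs r] by (auto simp: flip_id)
  qed
qed auto

text \<open>A flipped column \<open>(x, y)\<close> has \<open>x + r\<close> in the place of \<open>y\<close>, so this says that flipping it again
  is decided in the same way. The last flipped column is the witness: the next entry \<open>x'\<close> of the
  first row is kept, and \<open>x > x'\<close> gives \<open>x + r > x' + r\<close>.\<close>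

lemma exceeds_flip: "fits l n zs \<Longrightarrow> exceeds r n zs \<Longrightarrow> exceeds r (l + r) (flip r zs)"
proof (induction l n zs rule: fits.induct)
  case (2 l n x y zs)
  then show ?case by (cases "exceeds r y zs") auto
qed auto

lemma flip_flip: "fits l n zs \<Longrightarrow> flip r (flip r zs) = zs"
proof (induction l n zs rule: fits.induct)
  case (2 l n x y zs)
  then show ?case
    using exceeds_flip[of x y zs r] exceeds_imp_le[of x y zs r]
    by (cases "exceeds r y zs") (auto simp: flip_id)
qed auto

lemma weight_flip: "fits l n zs \<Longrightarrow> weight (flip r zs) = weight zs"
proof (induction l n zs rule: fits.induct)
  case (2 l n x y zs)
  then show ?case using exceeds_imp_le[of x y zs r] by auto
qed auto

lemma exceeds_if_wide: "fits l n zs \<Longrightarrow> l + r \<le> n \<Longrightarrow> exceeds r n zs"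
  by (cases zs) auto

text \<open>As \<open>n - r \<le> l\<close>, every symbol of the second box satisfies the condition \<open>exceeds r (l + r)\<close>
  already at index \<open>0\<close>. Hence the same involution maps back.\<close>

lemma bij_betw_flip:
  assumes "r \<le> n" "n \<le> l + r"
  shows "bij_betw (flip r) {zs. fits l n zs \<and> exceeds r n zs} {zs. fits (n - r) (l + r) zs}"
proof (rule bij_betw_byWitness[where f' = "flip r"])
  show "flip r ` {zs. fits l n zs \<and> exceeds r n zs} \<subseteq> {zs. fits (n - r) (l + r) zs}"
    by (auto simp: fits_flip)
  show "flip r ` {zs. fits (n - r) (l + r) zs} \<subseteq> {zs. fits l n zs \<and> exceeds r n zs}"
  proof safe
    fix zs assume f: "fits (n - r) (l + r) zs"
    then have e: "exceeds r (l + r) zs" using assms by (auto intro: exceeds_if_wide)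
    show "fits l n (flip r zs)" "exceeds r n (flip r zs)"
      using fits_flip[OF f e] exceeds_flip[OF f e] assms by simp_all
  qed
qed (auto intro: flip_flip)


section \<open>Partitions and their Frobenius symbols\<close>

text \<open>Surrounds the partition \<open>\<nu>\<close> by a hook with arm \<open>x\<close> and leg \<open>y\<close>, that is, puts \<open>\<nu>\<close> at the
  lower right of the corner cell. This prepends \<open>(x, y)\<close> to the Frobenius symbol.\<close>

definition hook :: "nat \<Rightarrow> nat \<Rightarrow> nat list \<Rightarrow> nat list" where
  "hook x y \<nu> = Suc x # map Suc \<nu> @ replicate (y - length \<nu>) 1"

fun part_of :: "(nat \<times> nat) list \<Rightarrow> nat list" where
  "part_of [] = []"
| "part_of ((x, y) # zs) = hook x y (part_of zs)"

definition symbol :: "nat list \<Rightarrow> (nat \<times> nat) list" where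
  "symbol \<mu> = map (\<lambda>i. (arm \<mu> i, leg \<mu> i)) [1..<durfee \<mu> + 1]"

lemma sorted_wrt_ge_replicate: "sorted_wrt (\<ge>) (replicate k (m::nat))"
  by (induction k) auto

lemma hook_in_box:
  assumes "\<nu> \<in> partitions_in_box y x" "x < l" "y < n"
  shows "hook x y \<nu> \<in> partitions_in_box n l"
  using assms
  by (fastforce simp: hook_def partitions_in_box_def is_partition_def sorted_wrt_append
      sorted_wrt_map sorted_wrt_ge_replicate)

lemma sum_list_hook: "length \<nu> \<le> y \<Longrightarrow> sum_list (hook x y \<nu>) = Suc (x + y) + sum_list \<nu>"
proof -
  have "sum_list (map Suc \<nu>) = length \<nu> + sum_list \<nu>" for \<nu> by (induction \<nu>) auto
  then show "length \<nu> \<le> y \<Longrightarrow> ?thesis" by (simp add: hook_def sum_list_replicate)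
qed

lemma ferrers_hook:
  assumes "\<nu> \<in> partitions_in_box y x"
  shows "(i, j) \<in> ferrers (hook x y \<nu>) \<longleftrightarrow>
    i = 1 \<and> 1 \<le> j \<and> j \<le> Suc x \<or> j = 1 \<and> 1 \<le> i \<and> i \<le> Suc y \<or>
    (\<exists>i' j'. i = Suc i' \<and> j = Suc j' \<and> (i', j') \<in> ferrers \<nu>)"
proof (cases "i \<le> 1")
  case True
  then show ?thesis using assms
    by (auto simp: ferrers_def hook_def partitions_in_box_def le_Suc_eq)
next
  case False
  then obtain k where k: "i = Suc (Suc k)" by (metis not_less_eq_eq Suc_le_D One_nat_def)
  have len: "length \<nu> \<le> y" using assms by (simp add: partitions_in_box_def)
  show ?thesis
  proof (cases "k < length \<nu>")
    case True
    then show ?thesis using len k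
      by (cases j) (auto simp: ferrers_def hook_def nth_append)
  next
    case False
    then show ?thesis using len k
      by (cases "k < y") (auto simp: ferrers_def hook_def nth_append)
  qed
qed

lemma finite_ferrers_diagonal: "finite {i. (i, i) \<in> ferrers \<mu>}"
  by (rule finite_subset[of _ "{..length \<mu>}"]) (auto simp: ferrers_def)

lemma ferrers_pos: "(i, j) \<in> ferrers \<mu> \<Longrightarrow> 1 \<le> i \<and> 1 \<le> j"
  by (simp add: ferrers_def)

lemma symbol_hook:
  assumes "\<nu> \<in> partitions_in_box y x"
  shows "symbol (hook x y \<nu>) = (x, y) # symbol \<nu>"
proof -
  let ?\<mu> = "hook x y \<nu>"
  note F = ferrers_hook[OF assms]
  have "{i. (i, i) \<in> ferrers ?\<mu>} = insert 1 (Suc ` {i. (i, i) \<in> ferrers \<nu>})"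
    unfolding F by auto
  moreover have "1 \<notin> Suc ` {i. (i, i) \<in> ferrers \<nu>}" by (auto simp: ferrers_def)
  ultimately have d: "durfee ?\<mu> = Suc (durfee \<nu>)"
    by (simp add: durfee_def finite_ferrers_diagonal card_image)
  have "{j. 1 < j \<and> (1, j) \<in> ferrers ?\<mu>} = {1<..Suc x}"
    unfolding F by (auto dest: ferrers_pos)
  then have a1: "arm ?\<mu> 1 = x" by (simp add: arm_def)
  have "{k. 1 < k \<and> (k, 1) \<in> ferrers ?\<mu>} = {1<..Suc y}"
    unfolding F by (auto dest: ferrers_pos)
  then have l1: "leg ?\<mu> 1 = y" by (simp add: leg_def)
  have aS: "arm ?\<mu> (Suc i) = arm \<nu> i" if "1 \<le> i" for i
  proof -
    have "{j. Suc i < j \<and> (Suc i, j) \<in> ferrers ?\<mu>} = Suc ` {j. i < j \<and> (i, j) \<in> ferrers \<nu>}"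
      unfolding F using that by auto
    then show ?thesis by (simp add: arm_def card_image)
  qed
  have lS: "leg ?\<mu> (Suc i) = leg \<nu> i" if "1 \<le> i" for i
  proof -
    have "{k. Suc i < k \<and> (k, Suc i) \<in> ferrers ?\<mu>} = Suc ` {k. i < k \<and> (k, i) \<in> ferrers \<nu>}"
      unfolding F using that by auto
    then show ?thesis by (simp add: leg_def card_image)
  qed
  have "[1..<durfee ?\<mu> + 1] = 1 # map Suc [1..<durfee \<nu> + 1]"
    by (simp add: d map_Suc_upt upt_conv_Cons del: upt_Suc)
  then show ?thesis
    using a1 l1 by (simp add: symbol_def aS lS del: upt_Suc)
qed

lemma part_of_in_box: "fits l n zs \<Longrightarrow> part_of zs \<in> partitions_in_box n l"
proof (induction l n zs rule: fits.induct)
  case (1 l n)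
  then show ?case by (simp add: partitions_in_box_def is_partition_def)
qed (auto intro: hook_in_box)

lemma symbol_Nil: "symbol [] = []"
proof -
  have "{i. (i, i) \<in> ferrers []} = {}" by (auto simp: ferrers_def)
  then show ?thesis by (simp add: symbol_def durfee_def)
qed

lemma symbol_part_of: "fits l n zs \<Longrightarrow> symbol (part_of zs) = zs"
  by (induction l n zs rule: fits.induct) (auto simp: symbol_Nil symbol_hook part_of_in_box)

lemma sum_list_part_of: "fits l n zs \<Longrightarrow> sum_list (part_of zs) = weight zs"
proof (induction l n zs rule: fits.induct)
  case (2 l n x y zs)
  then have "length (part_of zs) \<le> y"
    using part_of_in_box[of x y zs] by (simp add: partitions_in_box_def)
  then show ?case using 2 by (simp add: sum_list_hook)
qed simp

lemma peel_first_column: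
  assumes "sorted_wrt (\<ge>) ps" "\<forall>p\<in>set ps. 0 < (p::nat)"
  shows "map Suc (map (\<lambda>p. p - 1) (filter ((<) 1) ps))
    @ replicate (length ps - length (filter ((<) 1) ps)) 1 = ps"
  using assms
proof (induction ps)
  case (Cons p ps)
  show ?case
  proof (cases "1 < p")
    case True
    then show ?thesis using Cons by simp
  next
    case False
    then have p: "p = 1" using Cons.prems by auto
    then have "\<forall>k\<in>set ps. k = 1" using Cons.prems by (auto simp: le_Suc_eq)
    then have "filter ((<) 1) ps = []" "replicate (length ps) 1 = ps"
      by (auto simp: filter_empty_conv intro: replicate_eqI[symmetric])
    then show ?thesis using p by simp
  qed
qed simp

text \<open>The outermost hook of a partition consists of its first row and first column; what remains is
  obtained by dropping the first part and lowering the others by one.\<close>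

lemma box_eq_hook:
  assumes "p # ps \<in> partitions_in_box n l"
  obtains \<nu> where "\<nu> \<in> partitions_in_box (length ps) (p - 1)"
    "p # ps = hook (p - 1) (length ps) \<nu>" "p - 1 < l" "length ps < n"
proof
  let ?\<nu> = "map (\<lambda>p. p - 1) (filter ((<) 1) ps)"
  have ps: "sorted_wrt (\<ge>) ps" "\<forall>p\<in>set ps. 0 < p" "0 < p" "\<forall>k\<in>set ps. k \<le> p"
    using assms by (auto simp: partitions_in_box_def is_partition_def)
  have "sorted_wrt (\<ge>) (filter ((<) 1) ps)" using ps(1) by (rule sorted_wrt_filter)
  then have "sorted_wrt (\<ge>) ?\<nu>"
    unfolding sorted_wrt_map by (rule sorted_wrt_mono_rel[rotated]) auto
  then show "?\<nu> \<in> partitions_in_box (length ps) (p - 1)"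
    using ps by (auto simp: partitions_in_box_def is_partition_def intro: diff_le_mono)
  show "p # ps = hook (p - 1) (length ps) ?\<nu>"
    using peel_first_column[OF ps(1,2)] ps(3) by (simp add: hook_def)
  show "p - 1 < l" "length ps < n"
    using assms by (auto simp: partitions_in_box_def is_partition_def)
qed

lemma part_of_surj:
  "\<mu> \<in> partitions_in_box n l \<Longrightarrow> \<exists>zs. fits l n zs \<and> part_of zs = \<mu>"
proof (induction n arbitrary: l \<mu> rule: less_induct)
  case (less n)
  show ?case
  proof (cases \<mu>)
    case Nil
    then show ?thesis by (intro exI[of _ "[]"]) simp
  next
    case (Cons p ps)
    with less.prems obtain \<nu> where \<nu>: "\<nu> \<in> partitions_in_box (length ps) (p - 1)"
      "\<mu> = hook (p - 1) (length ps) \<nu>" "p - 1 < l" "length ps < n"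
      by (metis box_eq_hook)
    with less.IH obtain zs where "fits (p - 1) (length ps) zs" "part_of zs = \<nu>" by blast
    with \<nu> show ?thesis by (intro exI[of _ "(p - 1, length ps) # zs"]) simp
  qed
qed

lemma bij_betw_part_of: "bij_betw part_of {zs. fits l n zs} (partitions_in_box n l)"
  unfolding bij_betw_def
proof
  show "inj_on part_of {zs. fits l n zs}"
    by (rule inj_on_inverseI[of _ symbol]) (auto intro: symbol_part_of)
  show "part_of ` {zs. fits l n zs} = partitions_in_box n l"
    using part_of_surj by (force intro: part_of_in_box)
qed


section \<open>The level sets of the statistic\<close>

lemma exceeds_iff_nth:
  "exceeds r n zs \<longleftrightarrow>
    (\<exists>i\<le>length zs. int r < (int n # map (int \<circ> snd) zs) ! i - (map (int \<circ> fst) zs @ [-1]) ! i)"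
proof (induction r n zs rule: exceeds.induct)
  case (2 r n x y zs)
  have "(\<exists>i\<le>Suc k. P i) \<longleftrightarrow> P 0 \<or> (\<exists>i\<le>k. P (Suc i))" for k and P :: "nat \<Rightarrow> bool"
    by (metis Suc_le_mono not0_implies_Suc le0)
  then show ?case using 2 by auto
qed auto

lemma le_E1_part_of:
  assumes "fits l n zs"
  shows "int r \<le> E1 (part_of zs) n \<longleftrightarrow> exceeds r n zs"
proof -
  let ?\<mu> = "part_of zs"
  let ?D = "\<lambda>i. (int n # map (int \<circ> snd) zs) ! i - (map (int \<circ> fst) zs @ [-1]) ! i"
  have s: "symbol ?\<mu> = zs" by (rule symbol_part_of[OF assms])
  then have len: "durfee ?\<mu> = length zs"
    by (metis symbol_def length_map length_upt diff_add_inverse2)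
  have "frobenius ?\<mu> = (map fst (symbol ?\<mu>), map snd (symbol ?\<mu>))"
    by (simp add: frobenius_def symbol_def)
  then have "E1 ?\<mu> n = Max (?D ` {..length zs}) - 1"
    by (simp add: E1_def s len image_def atMost_def Bex_def conj_commute)
  then have "int r \<le> E1 ?\<mu> n \<longleftrightarrow> int r < Max (?D ` {..length zs})" by linarith
  also have "\<dots> \<longleftrightarrow> (\<exists>i\<le>length zs. int r < ?D i)"
    by (subst Max_gr_iff) auto
  finally show ?thesis by (simp only: exceeds_iff_nth)
qed

text \<open>The index \<open>i = d\<close> contributes \<open>y\<^sub>d + 1 > 0\<close> to the maximum (\<open>n + 1\<close> if \<open>d = 0\<close>), and no term is
  larger than \<open>n + 1\<close>.\<close>

lemma E1_bounds:
  assumes "\<mu> \<in> partitions_in_box n l"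
  shows "0 \<le> E1 \<mu> n" "E1 \<mu> n \<le> int n"
proof -
  obtain zs where zs: "fits l n zs" "\<mu> = part_of zs" using part_of_surj[OF assms] by auto
  note iff = le_E1_part_of[OF zs(1), folded zs(2)]
  show "0 \<le> E1 \<mu> n" using iff[of 0] exceeds_0[OF zs(1)] by simp
  have "\<not> exceeds (Suc n) n zs" using exceeds_imp_le[OF zs(1), of "Suc n"] by auto
  then show "E1 \<mu> n \<le> int n" using iff[of "Suc n"] by simp
qed

text \<open>Each change of summation is a bijection: from partitions to their Frobenius symbols, from there
  to the symbols of the second box by flipping, and back to partitions. For \<open>r > n\<close> both sides
  vanish.\<close>

theorem box_sum_E1_ge:
  assumes "n \<le> l + r"
  shows "(\<Sum>\<mu> \<in> {\<mu> \<in> partitions_in_box n l. int r \<le> E1 \<mu> n}. qvar ^ sum_list \<mu>)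
    = gauss_poly (n + l) (int n - int r)"
proof (cases "r \<le> n")
  case False
  then have "{\<mu> \<in> partitions_in_box n l. int r \<le> E1 \<mu> n} = {}"
    using E1_bounds(2) by fastforce
  then show ?thesis unfolding \<open>_ = {}\<close> using False by (simp add: gauss_poly_def)
next
  case True
  have "bij_betw part_of {zs \<in> {zs. fits l n zs}. exceeds r n zs}
      {\<mu> \<in> partitions_in_box n l. int r \<le> E1 \<mu> n}"
  proof (rule bij_betw_subset[OF bij_betw_part_of[of l n]])
    show "part_of ` {zs \<in> {zs. fits l n zs}. exceeds r n zs} =
        {\<mu> \<in> partitions_in_box n l. int r \<le> E1 \<mu> n}"
      using le_E1_part_of part_of_in_box part_of_surj by (fastforce simp: image_iff)
  qed auto
  then have "(\<Sum>\<mu> \<in> {\<mu> \<in> partitions_in_box n l. int r \<le> E1 \<mu> n}. qvar ^ sum_list \<mu>)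
      = (\<Sum>zs | fits l n zs \<and> exceeds r n zs. qvar ^ sum_list (part_of zs))"
    by (subst sum.reindex_bij_betw[symmetric]) simp_all
  also have "\<dots> = (\<Sum>zs | fits l n zs \<and> exceeds r n zs. qvar ^ weight (flip r zs))"
    by (rule sum.cong) (auto simp: sum_list_part_of weight_flip)
  also have "\<dots> = (\<Sum>zs | fits (n - r) (l + r) zs. qvar ^ weight zs)"
    by (rule sum.reindex_bij_betw[OF bij_betw_flip[OF True assms]])
  also have "\<dots> = (\<Sum>zs | fits (n - r) (l + r) zs. qvar ^ sum_list (part_of zs))"
    by (rule sum.cong) (auto simp: sum_list_part_of)
  also have "\<dots> = (\<Sum>\<mu>\<in>partitions_in_box (l + r) (n - r). qvar ^ sum_list \<mu>)"
    by (rule sum.reindex_bij_betw[OF bij_betw_part_of])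
  also have "\<dots> = gauss_poly (n + l) (int n - int r)"
    using gauss_poly_eq_box_sum[of "l + r" "n - r"] True by (simp add: of_nat_diff add.commute)
  finally show ?thesis .
qed

lemma box_sum_E1_eq:
  assumes "n \<le> l + r"
  shows "(\<Sum>\<mu> \<in> {\<mu> \<in> partitions_in_box n l. E1 \<mu> n = int r}. qvar ^ sum_list \<mu>)
    = gauss_poly (n + l) (int n - int r) - gauss_poly (n + l) (int n - int r - 1)"
proof -
  let ?A = "\<lambda>r. {\<mu> \<in> partitions_in_box n l. int r \<le> E1 \<mu> n}"
  have "{\<mu> \<in> partitions_in_box n l. E1 \<mu> n = int r} = ?A r - ?A (Suc r)" by auto
  moreover have "?A (Suc r) \<subseteq> ?A r" by auto
  ultimately show ?thesis
    using box_sum_E1_ge[of n l r] box_sum_E1_ge[of n l "Suc r"] assms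
    by (simp add: sum_diff finite_partitions_in_box diff_diff_eq add.commute)
qed

lemma alternating_sum_atMost: "(\<Sum>r\<le>e. (-1) ^ r) = (of_bool (even e) :: 'a::ring_1)"
  by (induction e) auto

text \<open>After the two summations are exchanged, \<open>\<mu>\<close> has the coefficient
  \<open>\<Sum>r\<le>E1 \<mu> n. (-1) ^ r\<close>, which is \<open>1\<close> or \<open>0\<close> according to the parity of \<open>E1 \<mu> n\<close>.\<close>

lemma box_sum_E1_even:
  assumes "n \<le> l"
  shows "(\<Sum>\<mu> \<in> {\<mu> \<in> partitions_in_box n l. even (E1 \<mu> n)}. qvar ^ sum_list \<mu>)
    = (\<Sum>r=0..n. (-1) ^ r * gauss_poly (n + l) (int n - int r))"
proof -
  let ?B = "partitions_in_box n l"
  have sign: "(\<Sum>r=0..n. (-1) ^ r * of_bool (int r \<le> E1 \<mu> n)) = (of_bool (even (E1 \<mu> n)) :: int poly)"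
    if \<mu>: "\<mu> \<in> ?B" for \<mu>
  proof -
    obtain e where e: "E1 \<mu> n = int e" "e \<le> n"
      using E1_bounds[OF \<mu>] zero_le_imp_eq_int by fastforce
    have "(\<Sum>r=0..n. (-1) ^ r * of_bool (int r \<le> E1 \<mu> n)) = (\<Sum>r\<le>e. (-1) ^ r :: int poly)"
      using e by (intro sum.mono_neutral_cong_right) auto
    then show ?thesis by (simp add: alternating_sum_atMost e)
  qed
  have "(\<Sum>r=0..n. (-1) ^ r * gauss_poly (n + l) (int n - int r))
      = (\<Sum>r=0..n. (-1) ^ r * (\<Sum>\<mu>\<in>?B. of_bool (int r \<le> E1 \<mu> n) * qvar ^ sum_list \<mu>))"
    using assms
    by (intro sum.cong refl arg_cong[where f = "(*) _"])
      (auto simp: box_sum_E1_ge[symmetric] finite_partitions_in_box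
        intro!: sum.mono_neutral_cong_left)
  also have "\<dots> = (\<Sum>\<mu>\<in>?B. (\<Sum>r=0..n. (-1) ^ r * of_bool (int r \<le> E1 \<mu> n)) * qvar ^ sum_list \<mu>)"
    unfolding sum_distrib_left sum_distrib_right by (subst sum.swap) (simp add: mult_ac)
  also have "\<dots> = (\<Sum>\<mu>\<in>?B. of_bool (even (E1 \<mu> n)) * qvar ^ sum_list \<mu>)"
    using sign by (intro sum.cong) auto
  also have "\<dots> = (\<Sum>\<mu> \<in> {\<mu> \<in> ?B. even (E1 \<mu> n)}. qvar ^ sum_list \<mu>)"
    by (intro sum.mono_neutral_cong_right) (auto simp: finite_partitions_in_box)
  finally show ?thesis by simp
qed

theorem corollary11:
  fixes n :: nat
  shows "(\<forall>a\<in>{0, 1}. \<forall>r\<le>n.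
            Z_poly (2 * n + a) n r =
              (\<Sum>\<mu> \<in> {\<mu> \<in> partitions_in_box n (n + a). E1 \<mu> n = int r}. qvar ^ sum_list \<mu>))
       \<and> B_poly n =
              (\<Sum>\<mu> \<in> {\<mu> \<in> partitions_in_box n (n + 1). even (E1 \<mu> n)}. qvar ^ sum_list \<mu>)"
proof -
  have "Z_poly (2 * n + a) n r =
      (\<Sum>\<mu> \<in> {\<mu> \<in> partitions_in_box n (n + a). E1 \<mu> n = int r}. qvar ^ sum_list \<mu>)" for a r
    using box_sum_E1_eq[of n "n + a" r] by (simp add: Z_poly_def mult_2 add.assoc)
  moreover have "B_poly n =
      (\<Sum>\<mu> \<in> {\<mu> \<in> partitions_in_box n (n + 1). even (E1 \<mu> n)}. qvar ^ sum_list \<mu>)"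
    using box_sum_E1_even[of n "n + 1"] by (simp add: B_poly_def mult_2)
  ultimately show ?thesis by blast
qed

end
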